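(* Suppose $k$ is an integer with $k\geq 2$. Then $\chi_{\ell flex}(K_1 \vee C_{2k+1}) = 4$.
   Context: All graphs are nonempty, finite, and simple. $\alpha(G)$ denotes the independence number of $G$. $C_n$ is the cycle on $n$ vertices. $G \vee H$ denotes the join of vertex-disjoint graphs $G$ and $H$ (every vertex of $G$ is made adjacent to every vertex of $H$). The Hall ratio of $G$ is $\rho(G)=\max_{\emptyset\neq H\subseteq G} |V(H)|/\alpha(H)$, the maximum being over all nonempty subgraphs $H$ of $G$. A list assignment $L$ for $G$ assigns to each vertex $v$ a set $L(v)$ of colors; it is an $m$-assignment if $|L(v)|=m$ for every $v \in V(G)$. A proper $L$-coloring of $G$ is a proper coloring $f$ with $f(v)\in L(v)$ for all $v \in V(G)$. A request of $L$ is a function $r$ with nonempty domain $D \subseteq V(G)$ such that $r(v)\in L(v)$ for each $v\in D$. For $\epsilon\in[0,1]$, the triple $(G,L,r)$ is $\epsilon$-satisfiable if there is a proper $L$-coloring $f$ of $G$ with $f(v)=r(v)$ for at least $\epsilon|D|$ vertices $v\in D$. The pair $(G,L)$ is $\epsilon$-flexible if $(G,L,r)$ is $\epsilon$-satisfiable for every request $r$ of $L$. $G$ is $(m,\epsilon)$-flexible if $(G,L)$ is $\epsilon$-flexible for every $m$-assignment $L$ for $G$. The list flexibility number $\chi_{\ell flex}(G)$ is the smallest $m$ such that $G$ is $(m,1/\rho(G))$-flexible. *)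

theory Defs
  imports Complex_Main "Graph_Theory.Graph_Theory"
begin

text \<open>
  A finite simple graph is a \<^locale>\<open>pair_graph\<close>: a finite, loop-free digraph with a symmetric
  arc relation, so that an edge \<open>uv\<close> is the pair of arcs \<open>(u, v)\<close> and \<open>(v, u)\<close>.
\<close>

subsection \<open>Complete graphs, cycles, joins\<close>

definition complete_graph :: "nat \<Rightarrow> nat pair_pre_digraph" where
  "complete_graph n = \<lparr> pverts = {..<n}, parcs = {(i, j). i < n \<and> j < n \<and> i \<noteq> j} \<rparr>"

text \<open>This is the cycle \<open>C\<^sub>n\<close> only for \<open>n \<ge> 3\<close>.\<close>

definition cycle_graph :: "nat \<Rightarrow> nat pair_pre_digraph" where
  "cycle_graph n = \<lparr> pverts = {..<n},
     parcs = {(i, j). i < n \<and> j < n \<and> (j = Suc i mod n \<or> i = Suc j mod n)} \<rparr>"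

text \<open>The two graphs are made vertex-disjoint by taking the sum of the vertex types.\<close>

definition graph_join ::
  "'a pair_pre_digraph \<Rightarrow> 'b pair_pre_digraph \<Rightarrow> ('a + 'b) pair_pre_digraph" where
  "graph_join G H = \<lparr> pverts = pverts G <+> pverts H,
     parcs = {(Inl u, Inl v) | u v. (u, v) \<in> parcs G}
           \<union> {(Inr u, Inr v) | u v. (u, v) \<in> parcs H}
           \<union> {(Inl u, Inr v) | u v. u \<in> pverts G \<and> v \<in> pverts H}
           \<union> {(Inr v, Inl u) | u v. u \<in> pverts G \<and> v \<in> pverts H} \<rparr>"

lemma complete_digraph_complete_graph: "complete_digraph n (with_proj (complete_graph n))"
  unfolding complete_digraph_pair_def by (auto simp: complete_graph_def)

lemma pair_graph_complete_graph: "pair_graph (complete_graph n)"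
  by (rule pair_graphI_complete[OF complete_digraph_complete_graph])

lemma pair_graphI:
  assumes "finite (pverts G)"
    and "\<And>u v. (u, v) \<in> parcs G \<Longrightarrow>
      u \<in> pverts G \<and> v \<in> pverts G \<and> u \<noteq> v \<and> (v, u) \<in> parcs G"
  shows "pair_graph G"
proof -
  have "parcs G \<subseteq> pverts G \<times> pverts G"
    using assms(2) by auto
  then have "finite (parcs G)"
    using assms(1) by (meson finite_SigmaI finite_subset)
  then show ?thesis
    using assms by unfold_locales (auto simp: symmetric_def intro!: symI)
qed

lemma pair_graph_cycle_graph:
  assumes "n \<ge> 3"
  shows "pair_graph (cycle_graph n)"
proof (rule pair_graphI)
  have ne: "i \<noteq> Suc i mod n" if "i < n" for i
    using that assms by (cases "Suc i = n") auto
  show "u \<in> pverts (cycle_graph n) \<and> v \<in> pverts (cycle_graph n) \<and> u \<noteq> v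
      \<and> (v, u) \<in> parcs (cycle_graph n)" if "(u, v) \<in> parcs (cycle_graph n)" for u v
    using that ne[of u] ne[of v] by (auto simp: cycle_graph_def)
qed (simp add: cycle_graph_def)

lemma pair_graph_graph_join:
  assumes "pair_graph G" "pair_graph H"
  shows "pair_graph (graph_join G H)"
proof -
  interpret G: pair_graph G by fact
  interpret H: pair_graph H by fact
  have "(v, u) \<in> parcs G" if "(u, v) \<in> parcs G" for u v
    using G.pair_sym_arcs that by (auto simp: symmetric_def elim: symE)
  moreover have "(v, u) \<in> parcs H" if "(u, v) \<in> parcs H" for u v
    using H.pair_sym_arcs that by (auto simp: symmetric_def elim: symE)
  ultimately show ?thesis
    using G.pair_finite_verts H.pair_finite_verts
    by (intro pair_graphI)
      (auto simp: graph_join_def dest: G.in_arcsD1 G.in_arcsD2 H.in_arcsD1 H.in_arcsD2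
        G.no_loops' H.no_loops')
qed

subsection \<open>Independence number and Hall ratio\<close>

definition independent_set :: "'a pair_pre_digraph \<Rightarrow> 'a set \<Rightarrow> bool" where
  "independent_set G S \<longleftrightarrow> S \<subseteq> pverts G \<and> (\<forall>u\<in>S. \<forall>v\<in>S. (u, v) \<notin> parcs G)"

definition independence_number :: "'a pair_pre_digraph \<Rightarrow> nat" where
  "independence_number G = Max {card S | S. independent_set G S}"

definition hall_ratio :: "'a pair_pre_digraph \<Rightarrow> real" where
  "hall_ratio G = Max {real (card (pverts H)) / real (independence_number H) | H.
     pair_graph H \<and> subgraph (with_proj H) (with_proj G) \<and> pverts H \<noteq> {}}"

subsection \<open>List colouring and flexibility\<close>

text \<open>
  Colours are natural numbers. This loses no generality: the lists of a finite graph involve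
  only finitely many colours.
\<close>

definition list_assignment :: "'a pair_pre_digraph \<Rightarrow> nat \<Rightarrow> ('a \<Rightarrow> nat set) \<Rightarrow> bool" where
  "list_assignment G m L \<longleftrightarrow> (\<forall>v\<in>pverts G. finite (L v) \<and> card (L v) = m)"

definition proper_list_coloring ::
  "'a pair_pre_digraph \<Rightarrow> ('a \<Rightarrow> nat set) \<Rightarrow> ('a \<Rightarrow> nat) \<Rightarrow> bool" where
  "proper_list_coloring G L f \<longleftrightarrow>
     (\<forall>v\<in>pverts G. f v \<in> L v) \<and> (\<forall>(u, v)\<in>parcs G. f u \<noteq> f v)"

definition list_request ::
  "'a pair_pre_digraph \<Rightarrow> ('a \<Rightarrow> nat set) \<Rightarrow> ('a \<rightharpoonup> nat) \<Rightarrow> bool" where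
  "list_request G L r \<longleftrightarrow>
     dom r \<noteq> {} \<and> dom r \<subseteq> pverts G \<and> (\<forall>v\<in>dom r. the (r v) \<in> L v)"

definition satisfiable ::
  "'a pair_pre_digraph \<Rightarrow> ('a \<Rightarrow> nat set) \<Rightarrow> ('a \<rightharpoonup> nat) \<Rightarrow> real \<Rightarrow> bool" where
  "satisfiable G L r \<epsilon> \<longleftrightarrow>
     (\<exists>f. proper_list_coloring G L f \<and>
        real (card {v \<in> dom r. f v = the (r v)}) \<ge> \<epsilon> * real (card (dom r)))"

definition flexible_lists ::
  "'a pair_pre_digraph \<Rightarrow> ('a \<Rightarrow> nat set) \<Rightarrow> real \<Rightarrow> bool" where
  "flexible_lists G L \<epsilon> \<longleftrightarrow> (\<forall>r. list_request G L r \<longrightarrow> satisfiable G L r \<epsilon>)"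

definition flexible :: "'a pair_pre_digraph \<Rightarrow> nat \<Rightarrow> real \<Rightarrow> bool" where
  "flexible G m \<epsilon> \<longleftrightarrow> (\<forall>L. list_assignment G m L \<longrightarrow> flexible_lists G L \<epsilon>)"

text \<open>
  List sizes are positive. The condition \<open>1 \<le> m\<close> is needed: if all lists are empty there
  is no request, so every graph is vacuously flexible with \<open>m = 0\<close>.
\<close>

definition list_flexibility_number :: "'a pair_pre_digraph \<Rightarrow> nat" where
  "list_flexibility_number G = (LEAST m. 1 \<le> m \<and> flexible G m (1 / hall_ratio G))"

end

theory Submission
  imports Defs
begin

text \<open>
  Write \<open>W\<close> for the wheel \<open>K\<^sub>1 \<or> C\<^sub>n\<close>, with hub \<open>Inl 0\<close> and rim vertices \<open>Inr i\<close>.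

  The structural fact behind both the Hall ratio and the flexibility is that a cycle
  minus a vertex is bipartite, so that every proper subset of the rim contains an independent set
  of at least half its size (\<open>half_independent\<close>). For \<open>n \<ge> 5\<close> no subgraph of \<open>W\<close> then has
  a larger ratio of order to independence number than a triangle, so the Hall ratio is \<open>3\<close> (\<open>hall_ratio_wheel\<close>)
  and flexibility asks for a third of the requests.

  Lists of size \<open>4\<close> suffice (\<open>flexible_wheel\<close>). Rim vertices have degree \<open>3\<close>, so any proper
  partial colouring that colours the hub extends greedily. Hence, once the hub has colour \<open>c\<close>, the
  requests on an independent set of rim vertices not asking for \<open>c\<close> can all be granted.
  Give the value \<open>2\<close> to granting a request at the hub, and the value \<open>1\<close> to each rim request for a
  colour other than \<open>c\<close>, half of which can be granted. A rim request clashes with at most one of the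
  four colours \<open>c\<close>, so if there are \<open>d\<close> rim requests and \<open>e \<le> 1\<close> hub requests, the values of the
  four choices of \<open>c\<close> add up to at least \<open>2e + 3d\<close>. The best choice grants at least
  \<open>(2e + 3d)/8\<close> requests, which is at least \<open>(d + e)/3\<close> unless \<open>e = 1\<close> and \<open>d \<le> 1\<close>, and then granting
  the hub request alone is enough. If every rim vertex requests a colour other than \<open>c\<close>, an independent
  set may fall short of half of the rim, but it can be given \<open>\<lfloor>n/2\<rfloor>\<close> vertices, which is
  at least \<open>(n + 1)/3\<close> for \<open>n \<ge> 5\<close>.

  Smaller lists fail because an odd wheel is not \<open>3\<close>-colourable: if all lists are equal
  there is no proper colouring at all, let alone one that grants requests.
\<close>

section \<open>Independent sets in cycles\<close>

text \<open>
  The colouring is by the parity of the distance from the removed vertex \<open>j\<close>, measured in the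
  direction of increasing index and with \<open>n - 1\<close> followed by \<open>0\<close>.
\<close>

lemma cycle_minus_vertex_bipartite:
  assumes "j < n"
  obtains b :: "nat \<Rightarrow> bool" where
    "\<And>u v. (u, v) \<in> parcs (cycle_graph n) \<Longrightarrow> u \<noteq> j \<Longrightarrow> v \<noteq> j \<Longrightarrow> b u \<noteq> b v"
proof
  define q where "q v = (if v > j then v - j else v + n - j)" for v
  have step: "q (Suc u mod n) = Suc (q u)" if "u < n" "Suc u mod n \<noteq> j" "u \<noteq> j" for u
    using that assms by (cases "Suc u = n") (auto simp: q_def)
  show "even (q u) \<noteq> even (q v)"
    if "(u, v) \<in> parcs (cycle_graph n)" "u \<noteq> j" "v \<noteq> j" for u v
    using that step[of u] step[of v] by (auto simp: cycle_graph_def)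
qed

lemma half_independent:
  assumes "S \<subset> {..<n}"
  obtains I where "I \<subseteq> S" "independent_set (cycle_graph n) I" "card S \<le> 2 * card I"
proof -
  obtain j where j: "j < n" "j \<notin> S" using assms by auto
  obtain b :: "nat \<Rightarrow> bool" where b:
    "\<And>u v. (u, v) \<in> parcs (cycle_graph n) \<Longrightarrow> u \<noteq> j \<Longrightarrow> v \<noteq> j \<Longrightarrow> b u \<noteq> b v"
    using cycle_minus_vertex_bipartite[OF j(1)] by blast
  define I where "I c = {v \<in> S. b v = c}" for c
  have ind: "independent_set (cycle_graph n) (I c)" for c
    unfolding independent_set_def
  proof (intro conjI ballI)
    show "I c \<subseteq> pverts (cycle_graph n)"
      using assms by (auto simp: I_def cycle_graph_def)
    show "(u, v) \<notin> parcs (cycle_graph n)" if "u \<in> I c" "v \<in> I c" for u v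
      using that b[of u v] j(2) by (auto simp: I_def)
  qed
  have "finite S" using assms finite_subset by blast
  then have "card (I True \<union> I False) = card (I True) + card (I False)"
    by (intro card_Un_disjoint) (auto simp: I_def)
  moreover have "I True \<union> I False = S" by (auto simp: I_def)
  ultimately have "card S \<le> 2 * card (I True) \<or> card S \<le> 2 * card (I False)" by auto
  moreover have "I c \<subseteq> S" for c by (auto simp: I_def)
  ultimately show thesis using that ind by blast
qed

text \<open>
  Only for the whole of an odd cycle can half fail. Dropping one vertex then still leaves
  an independent set of \<open>(n - 1)/2\<close> vertices, which for \<open>n \<ge> 5\<close> is at least \<open>(n + 1)/3\<close>, a third of the number of vertices
  of the wheel, hub included.
\<close>

lemma independent_subset_cycle:
  assumes "n \<ge> 5" "S \<subseteq> {..<n}"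
  obtains I where "I \<subseteq> S" "independent_set (cycle_graph n) I"
    "card S \<le> 2 * card I \<or> n + 1 \<le> 3 * card I"
proof (cases "S = {..<n}")
  case True
  obtain I where I: "I \<subseteq> {..<n - 1}" "independent_set (cycle_graph n) I" "n - 1 \<le> 2 * card I"
    using half_independent[of "{..<n - 1}" n] assms(1)
    by (metis card_lessThan diff_less lessThan_strict_subset_iff less_le_trans zero_less_numeral
        zero_less_one)
  have "n + 1 \<le> 3 * card I" using I(3) assms(1) by linarith
  with I(1,2) True show thesis by (intro that[of I]) auto
next
  case False
  with assms(2) have "S \<subset> {..<n}" by blast
  then show thesis using half_independent that by metis
qed

section \<open>The Hall ratio of a wheel\<close>

definition wheel_graph :: "nat \<Rightarrow> (nat + nat) pair_pre_digraph" where
  "wheel_graph n = graph_join (complete_graph 1) (cycle_graph n)"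

lemma pverts_wheel: "pverts (wheel_graph n) = insert (Inl 0) (Inr ` {..<n})"
  by (auto simp: wheel_graph_def graph_join_def complete_graph_def cycle_graph_def)

lemma parcs_wheel_simps:
  "(Inl i, Inl j) \<notin> parcs (wheel_graph n)"
  "(Inl i, Inr v) \<in> parcs (wheel_graph n) \<longleftrightarrow> i = 0 \<and> v < n"
  "(Inr v, Inl i) \<in> parcs (wheel_graph n) \<longleftrightarrow> i = 0 \<and> v < n"
  "(Inr u, Inr v) \<in> parcs (wheel_graph n) \<longleftrightarrow> (u, v) \<in> parcs (cycle_graph n)"
  by (auto simp: wheel_graph_def graph_join_def complete_graph_def cycle_graph_def)

lemma pair_graph_wheel: "n \<ge> 3 \<Longrightarrow> pair_graph (wheel_graph n)"
  unfolding wheel_graph_def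
  by (intro pair_graph_graph_join pair_graph_complete_graph pair_graph_cycle_graph)

lemma finite_independent_cards:
  assumes "finite (pverts G)"
  shows "finite {card S | S. independent_set G S}"
proof (rule finite_subset)
  show "{card S | S. independent_set G S} \<subseteq> card ` Pow (pverts G)"
    by (auto simp: independent_set_def)
qed (use assms in auto)

lemma card_le_independence_number:
  assumes "finite (pverts G)" "independent_set G S"
  shows "card S \<le> independence_number G"
  unfolding independence_number_def
  using assms by (intro Max_ge finite_independent_cards) auto

lemma independence_number_le:
  assumes "finite (pverts G)" "\<And>S. independent_set G S \<Longrightarrow> card S \<le> m"
  shows "independence_number G \<le> m"
proof -
  have "independent_set G {}" by (simp add: independent_set_def)
  then show ?thesis
    unfolding independence_number_def
    using assms by (subst Max_le_iff) (auto intro: finite_independent_cards)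
qed

lemma independence_number_pos:
  assumes "pair_graph G" "pverts G \<noteq> {}"
  shows "independence_number G \<ge> 1"
proof -
  interpret pair_graph G by fact
  obtain v where "v \<in> pverts G" using assms(2) by auto
  then have "independent_set G {v}"
    using no_loops' by (auto simp: independent_set_def)
  from card_le_independence_number[OF pair_finite_verts this] show ?thesis by simp
qed

lemma finite_hall_ratios:
  assumes "finite (pverts G)"
  shows "finite {real (card (pverts H)) / real (independence_number H) | H.
     pair_graph H \<and> subgraph (with_proj H) (with_proj G) \<and> pverts H \<noteq> {}}"
proof (rule finite_subset)
  let ?N = "card (pverts G)"
  show "{real (card (pverts H)) / real (independence_number H) | H.
     pair_graph H \<and> subgraph (with_proj H) (with_proj G) \<and> pverts H \<noteq> {}}
     \<subseteq> (\<lambda>(a, b). real a / real b) ` ({..?N} \<times> {..?N})"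
  proof clarsimp
    fix H :: "'a pair_pre_digraph"
    assume H: "subgraph (with_proj H) (with_proj G)"
    have sub: "pverts H \<subseteq> pverts G" using H by (auto elim!: subgraphE)
    have fin: "finite (pverts H)" using sub assms finite_subset by blast
    have "card (pverts H) \<le> ?N" using sub assms card_mono by blast
    moreover have "independence_number H \<le> card (pverts H)"
      using fin by (intro independence_number_le) (auto simp: independent_set_def card_mono)
    ultimately show "real (card (pverts H)) / real (independence_number H)
        \<in> (\<lambda>(a, b). real a / real b) ` ({..?N} \<times> {..?N})"
      by (intro image_eqI[of _ _ "(card (pverts H), independence_number H)"]) auto
  qed
qed simp

text \<open>
  A subgraph has at most one vertex off the rim, the hub. So half of its rim vertices, rounded up,
  amount to at least a third of all its vertices, unless it is the hub alone, which is independent.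
  Where half is not available, the bound \<open>n + 1\<close> on the number of all vertices is enough.
\<close>

lemma subgraph_wheel_card_le:
  assumes "n \<ge> 5" "pair_graph H" "subgraph (with_proj H) (with_proj (wheel_graph n))"
    "pverts H \<noteq> {}"
  shows "card (pverts H) \<le> 3 * independence_number H"
proof -
  interpret H: pair_graph H by fact
  have sub: "pverts H \<subseteq> pverts (wheel_graph n)" "parcs H \<subseteq> parcs (wheel_graph n)"
    using assms(3) by (auto elim!: subgraphE)
  define S where "S = {i. Inr i \<in> pverts H}"
  have S: "S \<subseteq> {..<n}" using sub(1) by (auto simp: S_def pverts_wheel)
  have finS: "finite S" using S finite_subset by blast
  obtain I where I: "I \<subseteq> S" "independent_set (cycle_graph n) I"
    "card S \<le> 2 * card I \<or> n + 1 \<le> 3 * card I"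
    using independent_subset_cycle[OF assms(1) S] by blast
  have "independent_set H (Inr ` I)"
    using I(1,2) sub(2) parcs_wheel_simps(4)
    by (fastforce simp: independent_set_def S_def)
  from card_le_independence_number[OF H.pair_finite_verts this]
  have \<alpha>: "card I \<le> independence_number H" by (simp add: card_image)
  have "pverts H \<subseteq> insert (Inl 0) (Inr ` S)"
    using sub(1) by (auto simp: S_def pverts_wheel)
  then have "card (pverts H) \<le> card (insert (Inl 0 :: nat + nat) (Inr ` S))"
    using finS by (intro card_mono) auto
  also have "\<dots> = card S + 1" using finS by (subst card_insert_disjoint) (auto simp: card_image)
  finally have "card (pverts H) \<le> card S + 1" .
  moreover have "card S \<le> n" using card_mono[OF _ S] by simp
  moreover have "1 \<le> independence_number H" using assms(2,4) by (rule independence_number_pos)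
  ultimately show ?thesis using \<alpha> I(3) by linarith
qed

lemma hall_ratio_wheel:
  assumes "n \<ge> 5"
  shows "hall_ratio (wheel_graph n) = 3"
  unfolding hall_ratio_def
proof (rule Max_eqI)
  show "finite {real (card (pverts H)) / real (independence_number H) | H.
     pair_graph H \<and> subgraph (with_proj H) (with_proj (wheel_graph n)) \<and> pverts H \<noteq> {}}"
    by (rule finite_hall_ratios) (simp add: pverts_wheel)
next
  fix y
  assume "y \<in> {real (card (pverts H)) / real (independence_number H) | H.
     pair_graph H \<and> subgraph (with_proj H) (with_proj (wheel_graph n)) \<and> pverts H \<noteq> {}}"
  then obtain H where y: "y = real (card (pverts H)) / real (independence_number H)"
    and H: "pair_graph H" "subgraph (with_proj H) (with_proj (wheel_graph n))" "pverts H \<noteq> {}"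
    by blast
  have "card (pverts H) \<le> 3 * independence_number H"
    using subgraph_wheel_card_le[OF assms H] .
  then have "real (card (pverts H)) \<le> 3 * real (independence_number H)" by linarith
  moreover have "0 < real (independence_number H)"
    using independence_number_pos[OF H(1,3)] by simp
  ultimately show "y \<le> 3" by (simp add: y divide_le_eq)
next
  \<comment> \<open>a triangle formed by the hub and an edge of the rim\<close>
  define T :: "(nat + nat) set" where "T = {Inl 0, Inr 0, Inr 1}"
  define H where "H = \<lparr> pverts = T, parcs = {(u, v). u \<in> T \<and> v \<in> T \<and> u \<noteq> v} \<rparr>"
  have H: "pair_graph H" by (rule pair_graphI) (auto simp: H_def T_def)
  interpret H: pair_graph H by (rule H)
  interpret W: pair_graph "wheel_graph n" using assms by (intro pair_graph_wheel) simp
  have arcs: "parcs H \<subseteq> parcs (wheel_graph n)"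
    using assms by (auto simp: H_def T_def parcs_wheel_simps cycle_graph_def)
  have "subgraph (with_proj H) (with_proj (wheel_graph n))"
    using assms arcs H.wf_digraph W.wf_digraph
    by (intro subgraphI) (auto simp: H_def T_def pverts_wheel compatible_def)
  moreover have "card T = 3" by (simp add: T_def)
  moreover have "independence_number H = 1"
  proof (rule antisym)
    show "independence_number H \<le> 1"
    proof (rule independence_number_le)
      fix S assume "independent_set H S"
      then have "S \<subseteq> T" "\<And>u v. u \<in> S \<Longrightarrow> v \<in> S \<Longrightarrow> u = v"
        by (auto simp: independent_set_def H_def)
      then show "card S \<le> 1" by (metis card_le_Suc0_iff_eq One_nat_def card.infinite zero_le)
    qed (simp add: H_def T_def)
    show "1 \<le> independence_number H"
      by (rule independence_number_pos[OF H]) (simp add: H_def T_def)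
  qed
  ultimately show "3 \<in> {real (card (pverts H)) / real (independence_number H) | H.
     pair_graph H \<and> subgraph (with_proj H) (with_proj (wheel_graph n)) \<and> pverts H \<noteq> {}}"
    using H by (intro CollectI exI[of _ H]) (auto simp: H_def T_def)
qed

section \<open>Lists of size four suffice\<close>

text \<open>
  Greedy colouring: a vertex whose list is larger than its degree always has a colour left, whatever
  its neighbours have received.
\<close>

lemma greedy_extension:
  assumes "pair_graph G" "S \<subseteq> pverts G"
    and "\<And>v. v \<in> S \<Longrightarrow> f v \<in> L v"
    and "\<And>u v. u \<in> S \<Longrightarrow> v \<in> S \<Longrightarrow> (u, v) \<in> parcs G \<Longrightarrow> f u \<noteq> f v"
    and "\<And>v. v \<in> pverts G - S \<Longrightarrow> card {u. (u, v) \<in> parcs G} < card (L v)"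
  obtains g where "proper_list_coloring G L g" "\<And>v. v \<in> S \<Longrightarrow> g v = f v"
proof -
  interpret pair_graph G by fact
  have "\<exists>g. (\<forall>v\<in>S \<union> U. g v \<in> L v) \<and> (\<forall>u\<in>S \<union> U. \<forall>v\<in>S \<union> U. (u, v) \<in> parcs G \<longrightarrow> g u \<noteq> g v)
      \<and> (\<forall>v\<in>S. g v = f v)"
    if "finite U" "U \<subseteq> pverts G - S" for U
    using that
  proof (induction U rule: finite_induct)
    case empty
    show ?case using assms(3,4) by (intro exI[of _ f]) auto
  next
    case (insert x U)
    then obtain g where g: "\<forall>v\<in>S \<union> U. g v \<in> L v"
      "\<forall>u\<in>S \<union> U. \<forall>v\<in>S \<union> U. (u, v) \<in> parcs G \<longrightarrow> g u \<noteq> g v" "\<forall>v\<in>S. g v = f v"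
      by auto
    have x: "x \<in> pverts G - S" using insert.prems by auto
    define N where "N = {u. (u, x) \<in> parcs G}"
    have "finite N"
      by (rule finite_subset[OF _ pair_finite_verts]) (auto simp: N_def dest: in_arcsD1)
    then have "finite (g ` N)" "card (g ` N) < card (L x)"
      using assms(5)[OF x] card_image_le[of N g] by (auto simp: N_def)
    then obtain c where c: "c \<in> L x" "c \<notin> g ` N"
      by (metis card_mono not_le subsetI)
    have sym: "u \<in> N" if "(x, u) \<in> parcs G" for u
      using that pair_sym_arcs by (auto simp: N_def symmetric_def elim: symE)
    have "x \<notin> S \<union> U" using x insert.hyps by auto
    moreover have "(x, x) \<notin> parcs G" using no_loops' by blast
    moreover have "\<forall>u. (u, x) \<in> parcs G \<or> (x, u) \<in> parcs G \<longrightarrow> g u \<noteq> c"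
      using c(2) sym by (auto simp: N_def)
    ultimately show ?case
      using g c(1) x by (intro exI[of _ "g(x := c)"]) auto
  qed
  from this[of "pverts G - S"] assms(2) pair_finite_verts
  obtain g where g: "\<forall>v\<in>pverts G. g v \<in> L v"
      "\<forall>u\<in>pverts G. \<forall>v\<in>pverts G. (u, v) \<in> parcs G \<longrightarrow> g u \<noteq> g v" "\<forall>v\<in>S. g v = f v"
    by (auto simp: Un_absorb1)
  show thesis
  proof
    show "proper_list_coloring G L g"
      using g(1,2) by (auto simp: proper_list_coloring_def dest: in_arcsD1 in_arcsD2)
  qed (use g(3) in auto)
qed

lemma rim_degree_le:
  assumes "v < n"
  shows "card {u. (u, Inr v) \<in> parcs (wheel_graph n)} \<le> 3"
proof -
  have pred: "u = (if v = 0 then n - 1 else v - 1)" if "u < n" "v = Suc u mod n" for u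
    using that assms by (cases "Suc u = n") auto
  have "{u. (u, Inr v) \<in> parcs (wheel_graph n)}
      \<subseteq> {Inl 0, Inr (Suc v mod n), Inr (if v = 0 then n - 1 else v - 1)}" (is "_ \<subseteq> ?N")
  proof
    fix u assume "u \<in> {u. (u, Inr v) \<in> parcs (wheel_graph n)}"
    then show "u \<in> ?N"
      using pred by (cases u) (auto simp: parcs_wheel_simps cycle_graph_def)
  qed
  then have "card {u. (u, Inr v) \<in> parcs (wheel_graph n)} \<le> card ?N"
    by (intro card_mono) auto
  also have "\<dots> \<le> 3" by (simp add: card_insert_if)
  finally show ?thesis .
qed

text \<open>
  The colour of the hub only rules out rim requests for that same colour; among the others, an
  independent set can be granted without producing a conflict on the rim.
\<close>

lemma grant_requests:
  assumes "n \<ge> 3" "list_assignment (wheel_graph n) 4 L" "list_request (wheel_graph n) L r"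
    and "c \<in> L (Inl 0)" "independent_set (cycle_graph n) I"
    and "\<And>i. i \<in> I \<Longrightarrow> Inr i \<in> dom r \<and> r (Inr i) \<noteq> Some c"
  obtains g where "proper_list_coloring (wheel_graph n) L g" "g (Inl 0) = c"
    "\<And>i. i \<in> I \<Longrightarrow> g (Inr i) = the (r (Inr i))"
proof -
  define f where "f v = (if v = Inl 0 then c else the (r v))" for v
  have I: "I \<subseteq> {..<n}" using assms(5) by (auto simp: independent_set_def cycle_graph_def)
  obtain g where g: "proper_list_coloring (wheel_graph n) L g"
    "\<And>v. v \<in> insert (Inl 0) (Inr ` I) \<Longrightarrow> g v = f v"
  proof (rule greedy_extension[of "wheel_graph n" "insert (Inl 0) (Inr ` I)" f L])
    show "pair_graph (wheel_graph n)" using assms(1) by (rule pair_graph_wheel)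
    show "insert (Inl 0) (Inr ` I) \<subseteq> pverts (wheel_graph n)"
      using I by (auto simp: pverts_wheel)
    show "f v \<in> L v" if "v \<in> insert (Inl 0) (Inr ` I)" for v
      using that assms(3,4,6) by (auto simp: f_def list_request_def)
    show "f u \<noteq> f v" if "u \<in> insert (Inl 0) (Inr ` I)" "v \<in> insert (Inl 0) (Inr ` I)"
        "(u, v) \<in> parcs (wheel_graph n)" for u v
      using that assms(5,6) by (fastforce simp: f_def parcs_wheel_simps independent_set_def)
    show "card {u. (u, v) \<in> parcs (wheel_graph n)} < card (L v)"
      if v: "v \<in> pverts (wheel_graph n) - insert (Inl 0) (Inr ` I)" for v
    proof -
      obtain i where "v = Inr i" "i < n" using v by (auto simp: pverts_wheel)
      moreover have "card (L v) = 4" using v assms(2) by (auto simp: list_assignment_def)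
      ultimately show ?thesis using rim_degree_le[of i n] by simp
    qed
  qed blast
  show thesis by (rule that[OF g(1)]) (auto simp: g(2) f_def)
qed

text \<open>
  Double counting: each rim request clashes with at most one colour of the hub, hence is counted
  for at least three of the four colours.
\<close>

lemma good_hub_colour:
  fixes r :: "nat + nat \<rightharpoonup> nat"
  assumes "finite C" "card C = 4" "finite D"
    and "\<And>c. r (Inl 0) = Some c \<Longrightarrow> c \<in> C"
  obtains c where "c \<in> C"
    "2 * of_bool (Inl 0 \<in> dom r) + 3 * card D
      \<le> 4 * (2 * of_bool (r (Inl 0) = Some c) + card {i \<in> D. r (Inr i) \<noteq> Some c})"
proof -
  let ?t = "\<lambda>c. 2 * of_bool (r (Inl 0) = Some c) + card {i \<in> D. r (Inr i) \<noteq> Some c}"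
  have hub: "of_bool (Inl 0 \<in> dom r) \<le> (\<Sum>c\<in>C. of_bool (r (Inl 0) = Some c) :: nat)"
  proof (cases "r (Inl 0)")
    case (Some a)
    then have "(\<Sum>c\<in>C. of_bool (r (Inl 0) = Some c) :: nat) = (\<Sum>c\<in>C. if a = c then 1 else 0)"
      by (intro sum.cong) auto
    also have "\<dots> = 1" using Some assms(1,4) by (simp add: sum.delta')
    finally show ?thesis by simp
  qed (simp add: domIff)
  have three: "3 \<le> (\<Sum>c\<in>C. of_bool (r (Inr i) \<noteq> Some c) :: nat)" for i
  proof -
    have "C - {the (r (Inr i))} \<subseteq> {c \<in> C. r (Inr i) \<noteq> Some c}" by auto
    then have "card (C - {the (r (Inr i))}) \<le> card {c \<in> C. r (Inr i) \<noteq> Some c}"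
      using assms(1) by (intro card_mono) auto
    moreover have "3 \<le> card (C - {the (r (Inr i))})"
      using assms(1,2) by (simp add: card_Diff_singleton_if)
    moreover have "(\<Sum>c\<in>C. of_bool (r (Inr i) \<noteq> Some c) :: nat) = card {c \<in> C. r (Inr i) \<noteq> Some c}"
      using assms(1) by (simp add: sum.If_cases of_bool_def Int_def)
    ultimately show ?thesis by simp
  qed
  have "3 * card D \<le> (\<Sum>i\<in>D. \<Sum>c\<in>C. of_bool (r (Inr i) \<noteq> Some c))"
    using sum_mono[of D "\<lambda>_. 3 :: nat", OF three] by (simp add: mult.commute)
  also have "\<dots> = (\<Sum>c\<in>C. \<Sum>i\<in>D. of_bool (r (Inr i) \<noteq> Some c))"
    by (rule sum.swap)
  also have "\<dots> = (\<Sum>c\<in>C. card {i \<in> D. r (Inr i) \<noteq> Some c})"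
    using assms(3) by (intro sum.cong) (simp_all add: sum.If_cases of_bool_def Int_def)
  finally have total: "2 * of_bool (Inl 0 \<in> dom r) + 3 * card D \<le> (\<Sum>c\<in>C. ?t c)"
    using hub by (simp add: sum.distrib flip: sum_distrib_left)
  show thesis
  proof (rule ccontr)
    assume "\<not> thesis"
    then have less: "4 * ?t c < 2 * of_bool (Inl 0 \<in> dom r) + 3 * card D" if "c \<in> C" for c
      using that \<open>\<And>c. \<lbrakk>c \<in> C; _\<rbrakk> \<Longrightarrow> thesis\<close> by (meson not_le)
    have "(\<Sum>c\<in>C. 4 * ?t c) < (\<Sum>c\<in>C. 2 * of_bool (Inl 0 \<in> dom r) + 3 * card D)"
      using assms(1,2) less by (intro sum_strict_mono) auto
    also have "\<dots> = 4 * (2 * of_bool (Inl 0 \<in> dom r) + 3 * card D)"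
      by (simp only: sum_constant assms(2) of_nat_numeral)
    finally have "(\<Sum>c\<in>C. ?t c) < 2 * of_bool (Inl 0 \<in> dom r) + 3 * card D"
      by (simp only: sum_distrib_left[symmetric] mult_less_cancel1)
    with total show False by (meson not_le)
  qed
qed

lemma flexible_wheel:
  assumes "n \<ge> 5"
  shows "flexible (wheel_graph n) 4 (1 / 3)"
  unfolding flexible_def flexible_lists_def
proof (intro allI impI)
  fix L and r :: "nat + nat \<rightharpoonup> nat"
  assume L: "list_assignment (wheel_graph n) 4 L" and r: "list_request (wheel_graph n) L r"
  define D where "D = {i. Inr i \<in> dom r}"
  define e :: nat where "e = of_bool (Inl 0 \<in> dom r)"
  have e: "e \<le> 1" by (simp add: e_def)
  have domr: "dom r \<subseteq> insert (Inl 0) (Inr ` {..<n})"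
    using r by (auto simp: list_request_def pverts_wheel)
  have D: "D \<subseteq> {..<n}" using domr by (auto simp: D_def)
  have finD: "finite D" using D finite_subset by blast
  have find: "finite (dom r)" using domr finite_subset by blast
  have cardr: "card (dom r) = e + card D"
  proof -
    let ?h = "if Inl 0 \<in> dom r then {Inl 0 :: nat + nat} else {}"
    have "dom r = ?h \<union> Inr ` D"
    proof (rule set_eqI)
      show "v \<in> dom r \<longleftrightarrow> v \<in> ?h \<union> Inr ` D" for v
        using domr by (cases v) (auto simp: D_def)
    qed
    then have "card (dom r) = card (?h \<union> Inr ` D)"
      by (rule arg_cong)
    also have "\<dots> = e + card D"
      using finD by (subst card_Un_disjoint) (auto simp: card_image e_def)
    finally show ?thesis .
  qed
  have C: "finite (L (Inl 0))" "card (L (Inl 0)) = 4"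
    using L by (auto simp: list_assignment_def pverts_wheel)
  have hub: "a \<in> L (Inl 0)" if "r (Inl 0) = Some a" for a
    using that r by (force simp: list_request_def)
  have sat: "satisfiable (wheel_graph n) L r (1 / 3)"
    if c: "c \<in> L (Inl 0)" and I: "independent_set (cycle_graph n) I"
      "\<And>i. i \<in> I \<Longrightarrow> i \<in> D \<and> r (Inr i) \<noteq> Some c"
      and many: "e + card D \<le> 3 * (of_bool (r (Inl 0) = Some c) + card I)" for c I
  proof -
    obtain g where g: "proper_list_coloring (wheel_graph n) L g" "g (Inl 0) = c"
      "\<And>i. i \<in> I \<Longrightarrow> g (Inr i) = the (r (Inr i))"
      using grant_requests[OF _ L r c I(1)] I(2) assms by (auto simp: D_def)
    have finI: "finite I" using I(2) finD by (meson finite_subset subsetI)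
    let ?h = "if r (Inl 0) = Some c then {Inl 0 :: nat + nat} else {}"
    have "?h \<union> Inr ` I \<subseteq> {v \<in> dom r. g v = the (r v)}"
      using g(2,3) I(2) by (auto simp: D_def)
    then have "card (?h \<union> Inr ` I) \<le> card {v \<in> dom r. g v = the (r v)}"
      using find by (intro card_mono) auto
    moreover have "card (?h \<union> Inr ` I) = of_bool (r (Inl 0) = Some c) + card I"
      using finI by (subst card_Un_disjoint) (auto simp: card_image)
    ultimately have "of_bool (r (Inl 0) = Some c) + card I \<le> card {v \<in> dom r. g v = the (r v)}"
      by (simp only:)
    then have "card (dom r) \<le> 3 * card {v \<in> dom r. g v = the (r v)}"
      unfolding cardr by (rule le_trans[OF many mult_le_mono2])
    then have "1 / 3 * real (card (dom r)) \<le> real (card {v \<in> dom r. g v = the (r v)})"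
      by linarith
    with g(1) show ?thesis unfolding satisfiable_def by blast
  qed
  \<comment> \<open>averaging is enough when \<open>(2e + 3d)/8 \<ge> (d + e)/3\<close>, that is, when \<open>d \<ge> 2e\<close>\<close>
  show "satisfiable (wheel_graph n) L r (1 / 3)"
  proof (cases "2 * e \<le> card D")
    case True
    obtain c where c: "c \<in> L (Inl 0)"
      "2 * e + 3 * card D
        \<le> 4 * (2 * of_bool (r (Inl 0) = Some c) + card {i \<in> D. r (Inr i) \<noteq> Some c})"
      using good_hub_colour[OF C finD, of r] hub unfolding e_def by blast
    let ?S = "{i \<in> D. r (Inr i) \<noteq> Some c}"
    obtain I where I: "I \<subseteq> ?S" "independent_set (cycle_graph n) I"
      "card ?S \<le> 2 * card I \<or> n + 1 \<le> 3 * card I"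
      using independent_subset_cycle[OF assms, of ?S] D by blast
    have "card D \<le> n" using card_mono[OF _ D] by simp
    then have "e + card D \<le> 3 * (of_bool (r (Inl 0) = Some c) + card I)"
      using I(3) c(2) True e unfolding distrib_left by linarith
    then show ?thesis using sat[OF c(1) I(2)] I(1) by blast
  next
    case False
    then have "e = 1" "card D \<le> 1" using e by linarith+
    then obtain a where "r (Inl 0) = Some a" by (cases "r (Inl 0)") (auto simp: e_def domIff)
    then show ?thesis
      using sat[of a "{}"] hub \<open>e = 1\<close> \<open>card D \<le> 1\<close> by (simp add: independent_set_def)
  qed
qed

section \<open>Smaller lists do not suffice\<close>

text \<open>
  The wraparound edge is left out: along a path, two colours must alternate, so the ends of a path with
  an even number of edges agree, and the edge closing an odd cycle has ends of the same colour.
\<close>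

lemma even_path_2_colouring_ends_agree:
  assumes "finite A" "card A \<le> 2" "\<And>i. i \<le> 2 * k \<Longrightarrow> f i \<in> A"
    and "\<And>i. i < 2 * k \<Longrightarrow> f i \<noteq> f (Suc i)"
  shows "f (2 * k) = f 0"
proof -
  have two: "x = z" if "x \<in> A" "y \<in> A" "z \<in> A" "x \<noteq> y" "y \<noteq> z" for x y z
  proof (rule ccontr)
    assume "x \<noteq> z"
    then have "card {x, y, z} = 3" using that by simp
    moreover have "card {x, y, z} \<le> card A" using that assms(1) by (intro card_mono) auto
    ultimately show False using assms(2) by simp
  qed
  have "f (2 * i) = f 0" if "i \<le> k" for i
    using that
  proof (induction i)
    case (Suc i)
    have "f (2 * i) = f (Suc (Suc (2 * i)))"
      using Suc.prems assms(3)[of "2 * i"] assms(3)[of "Suc (2 * i)"] assms(3)[of "Suc (Suc (2 * i))"]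
        assms(4)[of "2 * i"] assms(4)[of "Suc (2 * i)"]
      by (intro two) auto
    with Suc show ?case by simp
  qed simp
  then show ?thesis by simp
qed

lemma odd_wheel_not_3_colourable:
  assumes "k \<ge> 1" "m \<le> 3"
  shows "\<not> proper_list_coloring (wheel_graph (2 * k + 1)) (\<lambda>_. {..<m}) f"
proof
  assume f: "proper_list_coloring (wheel_graph (2 * k + 1)) (\<lambda>_. {..<m}) f"
  have arc: "f u \<noteq> f v" if "(u, v) \<in> parcs (wheel_graph (2 * k + 1))" for u v
    using f that by (auto simp: proper_list_coloring_def)
  have mem: "f v \<in> {..<m}" if "v \<in> pverts (wheel_graph (2 * k + 1))" for v
    using f that by (auto simp: proper_list_coloring_def)
  have "f (Inr (2 * k)) = f (Inr 0)"
  proof (rule even_path_2_colouring_ends_agree[where f = "\<lambda>i. f (Inr i)"])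
    show "card ({..<m} - {f (Inl 0)}) \<le> 2"
      using assms(2) mem[of "Inl 0"] by (simp add: pverts_wheel)
    show "f (Inr i) \<in> {..<m} - {f (Inl 0)}" if "i \<le> 2 * k" for i
      using that mem[of "Inr i"] arc[of "Inl 0" "Inr i"]
      by (auto simp: pverts_wheel parcs_wheel_simps)
    show "f (Inr i) \<noteq> f (Inr (Suc i))" if "i < 2 * k" for i
      using that by (intro arc) (simp add: parcs_wheel_simps cycle_graph_def)
  qed simp
  moreover have "f (Inr (2 * k)) \<noteq> f (Inr 0)"
    using assms(1) by (intro arc) (simp add: parcs_wheel_simps cycle_graph_def)
  ultimately show False by blast
qed

lemma odd_wheel_not_flexible:
  assumes "k \<ge> 1" "1 \<le> m" "m \<le> 3"
  shows "\<not> flexible (wheel_graph (2 * k + 1)) m \<epsilon>"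
proof
  let ?W = "wheel_graph (2 * k + 1)" and ?L = "\<lambda>_ :: nat + nat. {..<m}"
  assume "flexible ?W m \<epsilon>"
  moreover have "list_assignment ?W m ?L" by (simp add: list_assignment_def)
  moreover have "list_request ?W ?L [Inl 0 \<mapsto> 0]"
    using assms(2) by (simp add: list_request_def pverts_wheel)
  ultimately have "satisfiable ?W ?L [Inl 0 \<mapsto> 0] \<epsilon>"
    by (auto simp: flexible_def flexible_lists_def)
  then show False
    using odd_wheel_not_3_colourable[OF assms(1,3)] by (auto simp: satisfiable_def)
qed

theorem proposition11:
  fixes k :: nat
  assumes "k \<ge> 2"
  shows "list_flexibility_number (graph_join (complete_graph 1) (cycle_graph (2 * k + 1))) = 4"
  unfolding list_flexibility_number_def wheel_graph_def[symmetric]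
proof (rule Least_equality)
  have n: "2 * k + 1 \<ge> 5" using assms by simp
  show "1 \<le> (4 :: nat) \<and> flexible (wheel_graph (2 * k + 1)) 4 (1 / hall_ratio (wheel_graph (2 * k + 1)))"
    using flexible_wheel[OF n] hall_ratio_wheel[OF n] by simp
next
  fix m
  assume "1 \<le> m \<and> flexible (wheel_graph (2 * k + 1)) m (1 / hall_ratio (wheel_graph (2 * k + 1)))"
  then show "4 \<le> m"
    using odd_wheel_not_flexible[of k m] assms by fastforce
qed

end
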